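(* For every integer $t \ge 8$, the integer $4t+4$ is a magic constant.
   Context: All graphs $G=(V,E)$ are finite, simple (undirected, no loops or multiple edges), with nonempty vertex set, and not necessarily connected. A positive integer $k$ is called a magic constant if there exist a graph $G=(V,E)$ and a bijection $f: V \to \{1,2,\dots,|V|\}$ such that for every vertex $v \in V$ the weight $w(v) = \sum_{u \in N(v)} f(u)$ equals $k$, where $N(v) = \{u \in V : uv \in E\}$ is the (open) neighborhood of $v$. *)

theory Defs
  imports "Graph_Theory.Pair_Digraph"
begin

text \<open>
  A finite simple graph is a \<^locale>\<open>pair_graph\<close>: a finite vertex set with a finite, symmetric,
  irreflexive set of arcs, each undirected edge being the two arcs (u, v) and (v, u).
  The null graph is not excluded by that locale, so nonemptiness is stated separately.
\<close>

definition neighborhood :: "'a pair_pre_digraph \<Rightarrow> 'a \<Rightarrow> 'a set" where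
  "neighborhood G v = {u \<in> pverts G. (u, v) \<in> parcs G}"

definition weight :: "'a pair_pre_digraph \<Rightarrow> ('a \<Rightarrow> nat) \<Rightarrow> 'a \<Rightarrow> nat" where
  "weight G f v = (\<Sum>u\<in>neighborhood G v. f u)"

definition distance_magic_labeling :: "'a pair_pre_digraph \<Rightarrow> ('a \<Rightarrow> nat) \<Rightarrow> nat \<Rightarrow> bool" where
  "distance_magic_labeling G f k \<longleftrightarrow>
     bij_betw f (pverts G) {1..card (pverts G)} \<and> (\<forall>v\<in>pverts G. weight G f v = k)"

text \<open>
  The existential quantifier has to range over graphs on a fixed vertex type; natural numbers
  suffice, as the lemma below shows.
\<close>

definition magic_constant :: "nat \<Rightarrow> bool" where
  "magic_constant k \<longleftrightarrow> k > 0 \<and>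
     (\<exists>(G :: nat pair_pre_digraph) f.
        pair_graph G \<and> pverts G \<noteq> {} \<and> distance_magic_labeling G f k)"

lemma magic_constant_any_vertex_type:
  fixes G :: "'a pair_pre_digraph"
  assumes "k > 0" "pair_graph G" "pverts G \<noteq> {}" "distance_magic_labeling G f k"
  shows "magic_constant k"
proof -
  interpret pair_graph G by fact
  define H where "H = \<lparr>pverts = f ` pverts G, parcs = map_prod f f ` parcs G\<rparr>"
  have inj: "inj_on f (pverts G)" and img: "f ` pverts G = {1..card (pverts G)}"
    and w: "\<And>v. v \<in> pverts G \<Longrightarrow> weight G f v = k"
    using assms(4) by (auto simp: distance_magic_labeling_def bij_betw_def)
  have card: "card (f ` pverts G) = card (pverts G)"
    using inj by (rule card_image)
  have "pair_graph H"
  proof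
    show "fst e \<in> pverts H" "snd e \<in> pverts H" if "e \<in> parcs H" for e
      using that by (auto simp: H_def dest: in_arcsD1 in_arcsD2)
    show "finite (pverts H)" "finite (parcs H)"
      by (auto simp: H_def pair_finite_verts pair_finite_arcs)
    show "symmetric (with_proj H)"
      by (force simp: H_def symmetric_def sym_def dest: arcs_symmetric)
    show "fst e \<noteq> snd e" if "e \<in> parcs H" for e
      using that inj_onD[OF inj]
      by (clarsimp simp: H_def) (metis in_arcsD1 in_arcsD2 no_loops')
  qed
  moreover have "distance_magic_labeling H id k"
  proof -
    have "weight H id (f v) = k" if v: "v \<in> pverts G" for v
    proof -
      have "neighborhood H (f v) = f ` neighborhood G v"
        using v inj_onD[OF inj]
        by (fastforce simp: H_def neighborhood_def dest: in_arcsD1 in_arcsD2)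
      moreover have "inj_on f (neighborhood G v)"
        using inj by (rule inj_on_subset) (auto simp: neighborhood_def)
      ultimately show ?thesis
        using w[OF v] by (simp add: weight_def sum.reindex)
    qed
    then have "\<forall>v\<in>pverts H. weight H id v = k"
      by (simp add: H_def)
    moreover have "bij_betw id (pverts H) {1..card (pverts H)}"
      using card img by (simp add: H_def)
    ultimately show ?thesis
      by (simp add: distance_magic_labeling_def)
  qed
  ultimately show ?thesis
    using assms(1,3) by (auto simp: magic_constant_def H_def)
qed

end

theory Submission
  imports Defs
begin

text \<open>
  Centring the labels of an odd-order graph at 0 turns the constant weight of a 4-regular
  graph into zero-sum neighbourhoods, a condition that does not change when larger labels are
  added. Octahedra on $\pm(t+1), \pm(t+2), \pm(t+3)$, whose antipodal pairs are opposite
  labels, therefore extend a solution for $t$ to one for $t+3$, and it suffices to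
  exhibit solutions for $t = 8, 9, 10$ (found by computer search).
\<close>

text \<open>The centred labels themselves serve as vertices, so a graph is given by its
  neighbourhood function alone.\<close>

definition zero_sum_4_regular :: "nat \<Rightarrow> (int \<Rightarrow> int set) \<Rightarrow> bool" where
  "zero_sum_4_regular t N \<longleftrightarrow>
     (\<forall>u \<in> {- int t..int t}. N u \<subseteq> {- int t..int t} - {u} \<and> card (N u) = 4 \<and>
        \<Sum>(N u) = 0 \<and> (\<forall>v \<in> N u. u \<in> N v))"

text \<open>Moving the labels up by t + 1 turns them into 1, ..., 2t + 1 and adds t + 1 for each of
  four neighbours, so every zero sum becomes 4(t + 1).\<close>

lemma magic_constant_if_zero_sum_4_regular:
  assumes "zero_sum_4_regular t N"
  shows "magic_constant (4 * t + 4)"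
proof -
  define V where "V = {- int t..int t}"
  define G where "G = \<lparr>pverts = V, parcs = Sigma V N\<rparr>"
  define f where "f u = nat (u + int t + 1)" for u
  have N: "card (N u) = 4" "\<Sum>(N u) = 0"
      "\<And>v. v \<in> N u \<Longrightarrow> v \<in> V \<and> v \<noteq> u \<and> u \<in> N v" if "u \<in> V" for u
    using assms that unfolding zero_sum_4_regular_def V_def by blast+
  \<comment> \<open>Infinite sets have \<open>card\<close> 0, so cardinality 4 forces
    finiteness.\<close>
  have fin: "finite (N u)" if "u \<in> V" for u
    using N(1)[OF that] card.infinite[of "N u"] by auto
  have "pair_graph G"
  proof
    show "fst e \<in> pverts G" "snd e \<in> pverts G" "fst e \<noteq> snd e" if "e \<in> parcs G" for e
    proof -
      obtain u v where e: "e = (u, v)" "u \<in> V" "v \<in> N u" using \<open>e \<in> parcs G\<close> by (auto simp: G_def)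
      then show "fst e \<in> pverts G" "snd e \<in> pverts G" "fst e \<noteq> snd e"
        using N(3)[OF e(2,3)] by (simp_all add: G_def)
    qed
    show "finite (pverts G)" by (simp add: G_def V_def)
    show "finite (parcs G)" using finite_SigmaI[of V N] fin by (simp add: G_def V_def)
    have "(v, u) \<in> parcs G" if "(u, v) \<in> parcs G" for u v
      using that N(3)[of u v] by (simp add: G_def)
    then show "symmetric (with_proj G)" by (simp add: symmetric_def symI)
  qed
  moreover have "pverts G \<noteq> {}" by (simp add: G_def V_def)
  moreover have "distance_magic_labeling G f (4 * t + 4)"
  proof -
    have "card V = 2 * t + 1" by (simp add: V_def)
    moreover have "bij_betw f V {1..2 * t + 1}"
      by (rule bij_betwI[where g = "\<lambda>n. int n - int t - 1"]) (auto simp: f_def V_def)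
    moreover have "weight G f v = 4 * t + 4" if v: "v \<in> V" for v
    proof -
      \<comment> \<open>\<open>neighborhood\<close> collects the sources of arcs into
        \<open>v\<close>, whereas \<open>N v\<close> holds the targets of arcs out of
        \<open>v\<close>; symmetry identifies the two.\<close>
      have "u \<in> neighborhood G v \<longleftrightarrow> u \<in> N v" for u
        using v N(3)[of u v] N(3)[of v u] by (auto simp: neighborhood_def G_def)
      then have "neighborhood G v = N v" by blast
      \<comment> \<open>Centred labels may be negative, hence the passage to integers;
        \<open>nat\<close> in \<open>f\<close> truncates nothing, since u >= -t on
        \<open>V\<close>.\<close>
      moreover have "int (\<Sum>u\<in>N v. f u) = (\<Sum>u\<in>N v. u + (int t + 1))"
        unfolding of_nat_sum
      proof (rule sum.cong)
        show "int (f u) = u + (int t + 1)" if "u \<in> N v" for u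
          using N(3)[OF v that] by (simp add: f_def V_def)
      qed simp
      moreover have "\<dots> = 4 * (int t + 1)"
        using N(1,2)[OF v] by (simp add: sum.distrib)
      ultimately have "int (weight G f v) = int (4 * t + 4)"
        unfolding weight_def by simp
      then show ?thesis by (simp only: of_nat_eq_iff)
    qed
    ultimately show ?thesis by (simp add: distance_magic_labeling_def G_def)
  qed
  ultimately show ?thesis
    by (intro magic_constant_any_vertex_type) auto
qed

lemma zero_sum_4_regular_add_3:
  assumes "zero_sum_4_regular t N"
  obtains N' where "zero_sum_4_regular (t + 3) N'"
proof
  define S where "S = {- int t - 3, - int t - 2, - int t - 1, int t + 1, int t + 2, int t + 3}"
  \<comment> \<open>On \<open>S\<close> this is the octahedron K_{2,2,2}: \<open>u\<close> is joined
    to everything but itself and its antipode. The old graph stays as a disjoint part.\<close>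
  define N' where "N' u = (if u \<in> S then S - {u, - u} else N u)" for u
  have S: "S = {- int (t + 3)..int (t + 3)} - {- int t..int t}" by (auto simp: S_def)
  show "zero_sum_4_regular (t + 3) N'"
    unfolding zero_sum_4_regular_def
  proof
    fix u assume u: "u \<in> {- int (t + 3)..int (t + 3)}"
    show "N' u \<subseteq> {- int (t + 3)..int (t + 3)} - {u} \<and> card (N' u) = 4 \<and> \<Sum>(N' u) = 0 \<and>
        (\<forall>v \<in> N' u. u \<in> N' v)"
    proof (cases "u \<in> S")
      case True
      \<comment> \<open>Since \<open>u\<close> is nonzero, \<open>u\<close> and \<open>- u\<close>
        are distinct: removing them lowers the cardinality from 6 to 4 and leaves the sum at
        0.\<close>
      then have sub: "{u, - u} \<subseteq> S" and "u \<noteq> 0" by (auto simp: S_def)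
      have "card S = 6" "\<Sum>S = 0" "finite S" by (simp_all add: S_def)
      then have "card (S - {u, - u}) = 4" "\<Sum>(S - {u, - u}) = 0"
        using sub \<open>u \<noteq> 0\<close> by (simp_all add: card_Diff_subset sum_diff)
      then show ?thesis using True S by (auto simp: N'_def)
    next
      case False
      then have u': "u \<in> {- int t..int t}" using u S by blast
      then have "N u \<subseteq> {- int t..int t} - {u}" "card (N u) = 4" "\<Sum>(N u) = 0" "\<forall>v \<in> N u. u \<in> N v"
        using assms by (auto simp: zero_sum_4_regular_def)
      \<comment> \<open>Old neighbours avoid \<open>S\<close>, so \<open>N'\<close> agrees with
        \<open>N\<close> on them and symmetry carries over.\<close>
      moreover from this have "N u \<inter> S = {}" using S by auto
      ultimately show ?thesis using False by (auto simp: N'_def)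
    qed
  qed
qed

text \<open>Row \<open>i\<close> of a table lists the neighbours of the label \<open>i - t\<close>.\<close>

definition neighbour_table :: "nat \<Rightarrow> int list list \<Rightarrow> bool" where
  "neighbour_table t T \<longleftrightarrow>
     list_all (\<lambda>u. let l = T ! nat (u + int t) in
       distinct l \<and> length l = 4 \<and> sum_list l = 0 \<and>
       list_all (\<lambda>v. - int t \<le> v \<and> v \<le> int t \<and> v \<noteq> u \<and> u \<in> set (T ! nat (v + int t))) l)
     [- int t..int t]"

lemma zero_sum_4_regular_if_neighbour_table:
  assumes "neighbour_table t T"
  shows "zero_sum_4_regular t (\<lambda>u. set (T ! nat (u + int t)))"
  unfolding zero_sum_4_regular_def
proof
  fix u assume u: "u \<in> {- int t..int t}"
  define l where "l = T ! nat (u + int t)"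
  have "distinct l \<and> length l = 4 \<and> sum_list l = 0 \<and>
      (\<forall>v \<in> set l. - int t \<le> v \<and> v \<le> int t \<and> v \<noteq> u \<and> u \<in> set (T ! nat (v + int t)))"
    using assms u unfolding neighbour_table_def Let_def list_all_iff l_def set_upto by blast
  then show "set (T ! nat (u + int t)) \<subseteq> {- int t..int t} - {u} \<and>
      card (set (T ! nat (u + int t))) = 4 \<and> \<Sum>(set (T ! nat (u + int t))) = 0 \<and>
      (\<forall>v \<in> set (T ! nat (u + int t)). u \<in> set (T ! nat (v + int t)))"
    \<comment> \<open>For distinct entries, \<open>length\<close> and \<open>sum_list\<close> are
      the cardinality and the sum of the set of entries.\<close>
    unfolding l_def[symmetric] by (auto simp: distinct_card simp flip: distinct_sum_list_conv_Sum)
qed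

lemma neighbour_table_8:
  "neighbour_table 8
    [[-7, -5, 4, 8], [-8, -1, 3, 6], [-4, -3, 3, 4], [-8, 0, 1, 7], [-6, -2, 2, 6],
     [-6, -2, 1, 7], [-4, -3, 2, 5], [-7, 0, 2, 5], [-5, -1, 1, 5], [-5, -3, 0, 8],
     [-4, -2, -1, 7], [-7, -6, 5, 8], [-8, -6, 6, 8], [-2, -1, 0, 3], [-7, -4, 4, 7],
     [-5, -3, 2, 6], [-8, 1, 3, 4]]"
  by code_simp

lemma neighbour_table_9:
  "neighbour_table 9
    [[-5, -3, -1, 9], [-7, -1, 1, 7], [-8, -6, 6, 8], [-7, -2, 4, 5], [-9, -4, 6, 7],
     [-5, 0, 2, 3], [-9, 0, 4, 5], [-6, 1, 2, 3], [-9, -8, 8, 9], [-4, -3, 3, 4],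
     [-8, -2, 2, 8], [-4, -2, 1, 5], [-4, -2, 0, 6], [-6, -3, 0, 9], [-6, -3, 2, 7],
     [-7, -5, 3, 9], [-8, -5, 5, 8], [-7, -1, 1, 7], [-9, -1, 4, 6]]"
  by code_simp

lemma neighbour_table_10:
  "neighbour_table 10
    [[-4, -3, 0, 7], [-7, -5, 3, 9], [-6, -2, 0, 8], [-9, 2, 3, 4], [-8, -3, 5, 6],
     [-9, 1, 2, 6], [-10, -1, 1, 10], [-10, -6, 7, 9], [-8, -1, 4, 5], [-4, -2, 1, 5],
     [-10, -8, 8, 10], [-5, -4, -1, 10], [-7, -5, 4, 8], [-9, -7, 6, 10], [-7, -2, 2, 7],
     [-6, -2, -1, 9], [-6, -5, 3, 8], [-10, -3, 4, 9], [-8, 0, 2, 6], [-9, -3, 5, 7],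
     [-4, 0, 1, 3]]"
  by code_simp

theorem theorem2p7:
  fixes t :: nat
  assumes "t \<ge> 8"
  shows "magic_constant (4 * t + 4)"
proof -
  have "\<exists>N. zero_sum_4_regular t N"
    using assms
  proof (induction t rule: less_induct)
    case (less t)
    \<comment> \<open>Steps of length 3 need one base case per residue class modulo 3; from 11 on,
      \<open>t - 3\<close> is still at least 8.\<close>
    consider "t = 8" | "t = 9" | "t = 10" | "t \<ge> 11" using less.prems by linarith
    then show ?case
    proof cases
      case 4
      then have "t - 3 < t" "8 \<le> t - 3" "t - 3 + 3 = t" by linarith+
      then show ?thesis using less.IH zero_sum_4_regular_add_3 by metis
    qed (use neighbour_table_8 neighbour_table_9 neighbour_table_10
        zero_sum_4_regular_if_neighbour_table in blast)+
  qed
  then show ?thesis using magic_constant_if_zero_sum_4_regular by blast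
qed

end
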